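(* Let $k\ge2$ and let $\vec c,\vec d\in\{0,1\}^{k+1}$ differ in exactly one coordinate. (i) If $r,s$ are positive integers with $rs<\frac{n}{3(k-1)}$, then every $A\in L_n^k$ contains either a $<_{\vec c}$-monotone subsequence of length $r$ or a $<_{\vec d}$-monotone subsequence of length $s$. (ii) If $r,s\ge 9(k+10)$ and $rs>5kn$, then there exists $A\in L_n^k$ containing neither a $<_{\vec c}$-monotone subsequence of length $r$ nor a $<_{\vec d}$-monotone subsequence of length $s$.
   Context: An order-$n$ $k$-dimensional permutation is an array $A:[n]^{k+1}\to\{0,1\}$ such that every line contains exactly one $1$, where a line is the set of positions obtained by fixing $k$ of the $k+1$ coordinates and letting the remaining coordinate range over $[n]$; $L_n^k$ is the set of these, and $G_A=\{\alpha:A(\alpha)=1\}$ is the support. A vector $\vec c\in\{0,1\}^{k+1}$ induces a partial order on $\mathbb{R}^{k+1}$: $x<_{\vec c}y$ iff for each $1\le i\le k+1$, $x_i<y_i$ when $c_i=1$ and $y_i<x_i$ when $c_i=0$. A $<_{\vec c}$-monotone subsequence of length $m$ in $A$ is a sequence $\alpha^1,\dots,\alpha^m\in G_A$ with $\alpha^1<_{\vec c}\alpha^2<_{\vec c}\dots<_{\vec c}\alpha^m$. *)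

theory Defs
  imports Complex_Main "HOL-Library.FuncSet"
begin

text \<open>Vectors with \<open>k + 1\<close> coordinates are functions on the index set \<open>{1..k+1}\<close>, and
  \<open>[n]\<close> is \<open>{1..n}\<close>. Extensional function spaces are used so that distinct functions
  represent distinct vectors and arrays.\<close>

definition positions :: "nat \<Rightarrow> nat \<Rightarrow> (nat \<Rightarrow> nat) set" where
  "positions n k = {1..k+1} \<rightarrow>\<^sub>E {1..n}"

text \<open>A line is given by its free coordinate \<open>i\<close> and the values \<open>b\<close> of the other \<open>k\<close> coordinates.\<close>

definition line_through :: "nat \<Rightarrow> nat \<Rightarrow> nat \<Rightarrow> (nat \<Rightarrow> nat) \<Rightarrow> (nat \<Rightarrow> nat) set" where
  "line_through n k i b = {x \<in> positions n k. \<forall>j\<in>{1..k+1} - {i}. x j = b j}"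

definition lines :: "nat \<Rightarrow> nat \<Rightarrow> (nat \<Rightarrow> nat) set set" where
  "lines n k = {line_through n k i b | i b. i \<in> {1..k+1} \<and> b \<in> ({1..k+1} - {i}) \<rightarrow>\<^sub>E {1..n}}"

definition hd_permutations :: "nat \<Rightarrow> nat \<Rightarrow> ((nat \<Rightarrow> nat) \<Rightarrow> nat) set" where
  "hd_permutations n k =
     {A \<in> positions n k \<rightarrow>\<^sub>E {0, 1}. \<forall>l\<in>lines n k. \<exists>!x. x \<in> l \<and> A x = 1}"

definition support :: "nat \<Rightarrow> nat \<Rightarrow> ((nat \<Rightarrow> nat) \<Rightarrow> nat) \<Rightarrow> (nat \<Rightarrow> nat) set" where
  "support n k A = {x \<in> positions n k. A x = 1}"

definition sign_vectors :: "nat \<Rightarrow> (nat \<Rightarrow> nat) set" where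
  "sign_vectors k = {1..k+1} \<rightarrow>\<^sub>E {0, 1}"

text \<open>The order is stated for any linearly ordered coordinate type: for \<open>real\<close> it is the order on
  the whole Euclidean space, for \<open>nat\<close> its restriction to points with natural coordinates.\<close>

definition vec_less :: "nat \<Rightarrow> (nat \<Rightarrow> nat) \<Rightarrow> (nat \<Rightarrow> 'a::linorder) \<Rightarrow> (nat \<Rightarrow> 'a) \<Rightarrow> bool" where
  "vec_less k c x y \<longleftrightarrow>
     (\<forall>i\<in>{1..k+1}. (c i = 1 \<longrightarrow> x i < y i) \<and> (c i = 0 \<longrightarrow> y i < x i))"

definition monotone_subseq ::
    "nat \<Rightarrow> nat \<Rightarrow> (nat \<Rightarrow> nat) \<Rightarrow> ((nat \<Rightarrow> nat) \<Rightarrow> nat) \<Rightarrow> nat \<Rightarrow> (nat \<Rightarrow> nat \<Rightarrow> nat) \<Rightarrow> bool" where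
  "monotone_subseq n k c A m \<alpha> \<longleftrightarrow>
     (\<forall>j\<in>{1..m}. \<alpha> j \<in> support n k A) \<and>
     (\<forall>j\<in>{1..<m}. vec_less k c (\<alpha> j) (\<alpha> (j + 1)))"

definition has_monotone_subseq ::
    "nat \<Rightarrow> nat \<Rightarrow> (nat \<Rightarrow> nat) \<Rightarrow> ((nat \<Rightarrow> nat) \<Rightarrow> nat) \<Rightarrow> nat \<Rightarrow> bool" where
  "has_monotone_subseq n k c A m \<longleftrightarrow> (\<exists>\<alpha>. monotone_subseq n k c A m \<alpha>)"

end

theory Submission
  imports Defs
begin

text \<open>
  Flip coordinates so that both orders are increasing in every coordinate except the
  distinguished coordinate \<open>i\<close>, in which they disagree.

  (i) Label each point of the support by the lengths of the longest \<open>c\<close>- and \<open>d\<close>-monotone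
  subsequences ending there. In a class \<open>S\<close> of equal labels, points whose other coordinates are
  comparable share their \<open>i\<close>-th coordinate. At most \<open>k n\<^sup>k\<^sup>-\<^sup>1\<close> points of \<open>S\<close> are lowest in \<open>S\<close> on their
  diagonal, as there are at most that many diagonals. Two remaining points that differ only in
  one coordinate \<open>j\<close> besides \<open>i\<close> both dominate the point of \<open>S\<close> diagonally below the smaller one,
  so all three have the same \<open>i\<close>-th coordinate and the two points lie on one line; hence there are
  at most \<open>n\<^sup>k\<^sup>-\<^sup>1\<close> of them. So \<open>n\<^sup>k \<le> (r - 1) (s - 1) (k + 1) n\<^sup>k\<^sup>-\<^sup>1\<close>.

  (ii) Let the \<open>i\<close>-th coordinate be \<open>g (\<sigma> mod n)\<close>, where \<open>\<sigma>\<close> is the sum of the other coordinates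
  and \<open>g\<close> consists of increasing blocks of length \<open>b = s - k\<close>, each of them decreasing. Along a
  monotone subsequence \<open>\<sigma>\<close> grows by at least \<open>k\<close> in each step and passes through at most \<open>k\<close>
  periods. If the values increase, then the sum of the period and block numbers increases strictly;
  if they decrease, then every period stays inside one block and contributes at most
  \<open>\<lceil>b / k\<rceil>\<close> points.
\<close>

section \<open>Support points on lines, and labels by longest subsequences\<close>

lemma support_line_unique:
  assumes A: "A \<in> hd_permutations n k" and x: "x \<in> support n k A" and y: "y \<in> support n k A"
    and j: "j \<in> {1..k+1}" and eq: "\<And>l. l \<in> {1..k+1} - {j} \<Longrightarrow> x l = y l"
  shows "x = y"
proof -
  let ?b = "restrict x ({1..k+1} - {j})"
  let ?L = "line_through n k j ?b"
  have xp: "x \<in> positions n k" "A x = 1" "y \<in> positions n k" "A y = 1"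
    using x y by (auto simp: support_def)
  have "?b \<in> ({1..k+1} - {j}) \<rightarrow>\<^sub>E {1..n}"
    using xp(1) by (auto simp: positions_def PiE_def Pi_def)
  then have "?L \<in> lines n k"
    using j unfolding lines_def by blast
  then have "\<exists>!z. z \<in> ?L \<and> A z = 1"
    using A by (auto simp: hd_permutations_def)
  moreover have "x \<in> ?L" "y \<in> ?L"
    using xp eq by (auto simp: line_through_def)
  ultimately show ?thesis using xp by blast
qed

lemma support_line_ex:
  assumes A: "A \<in> hd_permutations n k" and j: "j \<in> {1..k+1}"
    and b: "b \<in> ({1..k+1} - {j}) \<rightarrow>\<^sub>E {1..n}"
  obtains x where "x \<in> support n k A" "\<And>l. l \<in> {1..k+1} - {j} \<Longrightarrow> x l = b l"
proof -
  have "line_through n k j b \<in> lines n k"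
    using j b unfolding lines_def by blast
  then have "\<exists>!z. z \<in> line_through n k j b \<and> A z = 1"
    using A by (auto simp: hd_permutations_def)
  then show ?thesis using that by (auto simp: line_through_def support_def)
qed

lemma finite_support: "finite (support n k A)"
  unfolding support_def positions_def by (simp add: finite_PiE)

text \<open>Forgetting coordinate \<open>1\<close> maps the support onto all \<open>n ^ k\<close>
  choices of the other coordinates, since each choice determines a line and that line carries a
  support point.\<close>

lemma card_support_ge:
  assumes A: "A \<in> hd_permutations n k"
  shows "n ^ k \<le> card (support n k A)"
proof -
  let ?J = "{1..k+1} - {1::nat}"
  have "?J \<rightarrow>\<^sub>E {1..n} \<subseteq> (\<lambda>x. restrict x ?J) ` support n k A"
  proof
    fix b assume b: "b \<in> ?J \<rightarrow>\<^sub>E {1..n}"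
    obtain x where x: "x \<in> support n k A" "\<And>l. l \<in> ?J \<Longrightarrow> x l = b l"
      using support_line_ex[OF A _ b] by auto
    have "restrict x ?J = b"
      using x(2) b by (intro ext) (auto simp: PiE_def extensional_def restrict_def)
    then show "b \<in> (\<lambda>x. restrict x ?J) ` support n k A" using x(1) by blast
  qed
  then have "card (?J \<rightarrow>\<^sub>E {1..n}) \<le> card (support n k A)"
    by (rule surj_card_le[OF finite_support])
  then show ?thesis by (simp add: card_PiE)
qed

text \<open>The label of \<open>x\<close> is the greatest length of a subsequence ending at
  \<open>x\<close>. Appending a later point \<open>y\<close> to such a subsequence gives a longer
  one ending at \<open>y\<close>, so labels grow along the order.\<close>

lemma monotone_label:
  assumes no: "\<not> has_monotone_subseq n k c A r"
  shows "\<exists>h. h ` support n k A \<subseteq> {1..<r} \<and>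
    (\<forall>x\<in>support n k A. \<forall>y\<in>support n k A. vec_less k c x y \<longrightarrow> h x < h y)"
proof -
  define L where "L x = {m. 1 \<le> m \<and> (\<exists>\<alpha>. monotone_subseq n k c A m \<alpha> \<and> \<alpha> m = x)}" for x
  have L_less: "m < r" if m: "m \<in> L x" for m x
  proof (rule ccontr)
    assume "\<not> m < r"
    moreover obtain \<alpha> where "monotone_subseq n k c A m \<alpha>" using m by (auto simp: L_def)
    \<comment> \<open>The first \<open>r\<close> terms of a longer monotone subsequence again form
      one.\<close>
    ultimately have "monotone_subseq n k c A r \<alpha>" by (auto simp: monotone_subseq_def)
    with no show False by (auto simp: has_monotone_subseq_def)
  qed
  have fin: "finite (L x)" for x
    by (rule finite_subset[of _ "{..<r}"]) (auto dest: L_less)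
  have one: "1 \<in> L x" if "x \<in> support n k A" for x
    using that unfolding L_def monotone_subseq_def by auto
  have step: "Suc m \<in> L y"
    if y: "y \<in> support n k A" and xy: "vec_less k c x y" and m: "m \<in> L x" for x y m
  proof -
    from m obtain \<alpha> where \<alpha>: "1 \<le> m" "monotone_subseq n k c A m \<alpha>" "\<alpha> m = x"
      by (auto simp: L_def)
    have "monotone_subseq n k c A (Suc m) (\<alpha>(Suc m := y))"
      unfolding monotone_subseq_def
    proof (intro conjI ballI)
      fix j assume "j \<in> {1..Suc m}"
      then show "(\<alpha>(Suc m := y)) j \<in> support n k A"
        using \<alpha> y by (auto simp: monotone_subseq_def)
    next
      fix j assume "j \<in> {1..<Suc m}"
      then show "vec_less k c ((\<alpha>(Suc m := y)) j) ((\<alpha>(Suc m := y)) (j + 1))"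
        using \<alpha> xy by (cases "j = m") (auto simp: monotone_subseq_def)
    qed
    then show ?thesis by (auto simp: L_def)
  qed
  show ?thesis
  proof (intro exI[of _ "\<lambda>x. Max (L x)"] conjI ballI impI)
    show "(\<lambda>x. Max (L x)) ` support n k A \<subseteq> {1..<r}"
    proof clarify
      fix x assume x: "x \<in> support n k A"
      then have "Max (L x) \<in> L x" using one fin by (intro Max_in) auto
      then show "Max (L x) \<in> {1..<r}" using L_less by (auto simp: L_def)
    qed
    fix x y assume xy: "x \<in> support n k A" "y \<in> support n k A" "vec_less k c x y"
    then have "Max (L x) \<in> L x" using one fin by (intro Max_in) auto
    then have "Suc (Max (L x)) \<in> L y" using step xy by blast
    then show "Max (L x) < Max (L y)" using fin by (simp add: Max_ge Suc_le_lessD)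
  qed
qed

section \<open>Counting by fibres and with one fixed coordinate\<close>

lemma card_le_fibers:
  assumes "finite G" "finite P" "f ` G \<subseteq> P" "\<And>p. p \<in> P \<Longrightarrow> card {x \<in> G. f x = p} \<le> B"
  shows "card G \<le> card P * B"
proof -
  have "card G = card (\<Union>p\<in>P. {x \<in> G. f x = p})"
    using assms(3) by (intro arg_cong[where f = card]) auto
  also have "\<dots> \<le> (\<Sum>p\<in>P. card {x \<in> G. f x = p})"
    by (rule card_UN_le[OF assms(2)])
  also have "\<dots> \<le> card P * B"
    using sum_bounded_above[of P, OF assms(4)] by simp
  finally show ?thesis .
qed

lemma card_PiE_fixed_le:
  assumes "finite J" "j \<in> J" "finite V"
  shows "card {g \<in> J \<rightarrow>\<^sub>E V. g j = a} \<le> card V ^ (card J - 1)"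
proof -
  let ?F = "{g \<in> J \<rightarrow>\<^sub>E V. g j = a}"
  have "inj_on (\<lambda>g. restrict g (J - {j})) ?F"
  proof (rule inj_onI)
    fix g h assume gh: "g \<in> ?F" "h \<in> ?F" "restrict g (J - {j}) = restrict h (J - {j})"
    have "l \<in> J - {j} \<Longrightarrow> g l = h l" for l
      using fun_cong[OF gh(3), of l] by simp
    then have "g l = h l" for l
      using gh(1,2) by (cases "l = j"; cases "l \<in> J") (auto simp: PiE_def extensional_def)
    then show "g = h" by blast
  qed
  moreover have "(\<lambda>g. restrict g (J - {j})) ` ?F \<subseteq> (J - {j}) \<rightarrow>\<^sub>E V"
  proof (intro image_subsetI)
    fix g assume "g \<in> ?F"
    then have "g \<in> J \<rightarrow>\<^sub>E V" by simp
    then show "restrict g (J - {j}) \<in> (J - {j}) \<rightarrow>\<^sub>E V"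
      by (intro restrict_PiE_iff[THEN iffD2]) (auto dest: PiE_mem)
  qed
  ultimately have "card ?F \<le> card ((J - {j}) \<rightarrow>\<^sub>E V)"
    using assms by (intro card_inj_on_le) (auto intro: finite_PiE)
  then show ?thesis using assms by (simp add: card_PiE)
qed

section \<open>Strict chains and the block reversal of \<open>[n]\<close>\<close>

lemma strict_chain_length_le:
  fixes f :: "nat \<Rightarrow> nat"
  assumes inc: "\<And>j. j \<in> {1..<m} \<Longrightarrow> f j < f (j + 1)" and bd: "\<And>j. j \<in> {1..m} \<Longrightarrow> f j < N"
  shows "m \<le> N"
proof (cases "m = 0")
  case False
  have "j \<le> m \<Longrightarrow> j \<le> f j + 1" if "1 \<le> j" for j
    using that
  proof (induction j rule: dec_induct)
    case (step l)
    then show ?case using inc[of l] by auto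
  qed simp
  from this[of m] bd[of m] False show ?thesis by auto
qed simp

text \<open>The function \<open>g\<close> of the construction. Arguments are residues and start at
  0, values are coordinates and start at 1. The \<open>min\<close> is the true length of the block
  of \<open>v\<close>, as the last block may be shorter than \<open>b\<close>.\<close>

definition block_reversal :: "nat \<Rightarrow> nat \<Rightarrow> nat \<Rightarrow> nat" where
  "block_reversal n b v = v div b * b + min b (n - v div b * b) - v mod b"

lemma block_reversal_bounds:
  assumes "v < n" "0 < b"
  shows "v div b * b < block_reversal n b v" "block_reversal n b v \<le> v div b * b + b"
    "block_reversal n b v \<le> n"
proof -
  have "v = v div b * b + v mod b" "v mod b < b" using assms(2) by simp_all
  then show "v div b * b < block_reversal n b v" "block_reversal n b v \<le> v div b * b + b"
    "block_reversal n b v \<le> n"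
    using assms(1) unfolding block_reversal_def by linarith+
qed

lemma block_reversal_blocks:
  assumes "u < n" "v < n" "0 < b" "u div b < v div b"
  shows "block_reversal n b u < block_reversal n b v"
proof -
  have "u div b * b + b \<le> v div b * b"
    using mult_le_mono1[of "Suc (u div b)" "v div b" b] assms(4) by simp
  then show ?thesis
    using block_reversal_bounds[of u n b] block_reversal_bounds[of v n b] assms by linarith
qed

lemma block_reversal_within:
  assumes "v < n" "0 < b" "u div b = v div b" "u < v"
  shows "block_reversal n b v < block_reversal n b u"
proof -
  have v: "v = v div b * b + v mod b" "v mod b < b" using assms(2) by simp_all
  have u: "u = v div b * b + u mod b"
    using div_mult_mod_eq[of u b] assms(3) by simp
  show ?thesis
    using v u assms(1,4) unfolding block_reversal_def assms(3) by linarith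
qed

lemma inj_on_block_reversal:
  assumes "0 < b"
  shows "inj_on (block_reversal n b) {..<n}"
proof (rule linorder_inj_onI)
  fix u v assume "u < v" "u \<in> {..<n}" "v \<in> {..<n}"
  then show "block_reversal n b u \<noteq> block_reversal n b v"
    using block_reversal_blocks[of u n v b] block_reversal_within[of v n b u] assms
      div_le_mono[of u v b] by (cases "u div b = v div b") auto
qed auto

lemma block_reversal_image:
  assumes "0 < b"
  shows "block_reversal n b ` {..<n} = {1..n}"
proof (rule card_subset_eq)
  show "block_reversal n b ` {..<n} \<subseteq> {1..n}"
  proof (intro image_subsetI)
    fix v assume "v \<in> {..<n}"
    then show "block_reversal n b v \<in> {1..n}"
      using block_reversal_bounds[of v n b] assms by auto
  qed
  show "card (block_reversal n b ` {..<n}) = card {1..n}"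
    using inj_on_block_reversal[OF assms] by (simp add: card_image)
qed simp

lemma add_mod_cancel:
  fixes a b m n :: nat
  assumes "a < n" "b < n" "(a + m) mod n = (b + m) mod n"
  shows "a = b"
  using assms
proof (induction a b rule: linorder_wlog)
  case (le a b)
  then have "n dvd (b + m) - (a + m)" using mod_eq_dvd_iff_nat[of "a + m" "b + m" n] by simp
  then show ?case using le dvd_imp_le[of n "b - a"] by fastforce
qed simp

section \<open>Normalising the signs\<close>

locale opposed_signs =
  fixes n k i :: nat and c d :: "nat \<Rightarrow> nat"
  assumes k_pos: "0 < k" and i: "i \<in> {1..k+1}" and ci: "c i = 1" and di: "d i = 0"
    and c01: "\<And>j. j \<in> {1..k+1} - {i} \<Longrightarrow> c j \<in> {0, 1}"
    and dc: "\<And>j. j \<in> {1..k+1} - {i} \<Longrightarrow> d j = c j"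
begin

definition J :: "nat set" where "J = {1..k+1} - {i}"

text \<open>Reflecting the coordinates with sign 0 makes both orders increasing on \<open>J\<close>.
  Starting at 0 suits both the sums modulo \<open>n\<close> and the diagonals, whose representatives
  have a coordinate 0.\<close>

definition coord :: "(nat \<Rightarrow> nat) \<Rightarrow> nat \<Rightarrow> nat" where
  "coord x j = (if c j = 1 then x j - 1 else n - x j)"

text \<open>This is the common part of both orders; coordinate \<open>i\<close> alone decides which
  of them applies.\<close>

definition below :: "(nat \<Rightarrow> nat) \<Rightarrow> (nat \<Rightarrow> nat) \<Rightarrow> bool" where
  "below x y \<longleftrightarrow> (\<forall>j\<in>J. coord x j < coord y j)"

lemma finite_J [simp]: "finite J" and card_J: "card J = k" and J_nonempty: "J \<noteq> {}"
proof -
  show "finite J" by (simp add: J_def)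
  show "card J = k" using i by (simp add: J_def)
  then show "J \<noteq> {}" using k_pos by auto
qed

lemma positions_range:
  assumes "x \<in> positions n k" "j \<in> {1..k+1}"
  shows "1 \<le> x j" "x j \<le> n"
  using PiE_mem[OF assms[unfolded positions_def]] by auto

lemma coord_less: "x \<in> positions n k \<Longrightarrow> j \<in> {1..k+1} \<Longrightarrow> coord x j < n"
  using positions_range[of x j] by (auto simp: coord_def)

lemma coord_eq_iff:
  "x \<in> positions n k \<Longrightarrow> y \<in> positions n k \<Longrightarrow> j \<in> {1..k+1} \<Longrightarrow> coord x j = coord y j \<longleftrightarrow> x j = y j"
  using positions_range[of x j] positions_range[of y j] by (auto simp: coord_def)

lemma coord_less_iff:
  assumes "x \<in> positions n k" "y \<in> positions n k" "j \<in> {1..k+1}"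
  shows "coord x j < coord y j \<longleftrightarrow> (if c j = 1 then x j < y j else y j < x j)"
  using positions_range[of x j] positions_range[of y j] assms by (auto simp: coord_def)

lemma vec_less_c:
  assumes "x \<in> positions n k" "y \<in> positions n k"
  shows "vec_less k c x y \<longleftrightarrow> below x y \<and> x i < y i"
proof -
  have "{1..k+1} = insert i J" using i by (auto simp: J_def)
  moreover have "\<forall>j\<in>J. j \<in> {1..k+1} \<and> c j \<in> {0, 1}"
    unfolding J_def using c01 by blast
  ultimately show ?thesis
    using coord_less_iff[OF assms] ci unfolding vec_less_def below_def by auto
qed

lemma vec_less_d:
  assumes "x \<in> positions n k" "y \<in> positions n k"
  shows "vec_less k d x y \<longleftrightarrow> below x y \<and> y i < x i"
proof -
  have "{1..k+1} = insert i J" using i by (auto simp: J_def)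
  moreover have "\<forall>j\<in>J. j \<in> {1..k+1} \<and> c j \<in> {0, 1} \<and> d j = c j"
    unfolding J_def using c01 dc by blast
  ultimately show ?thesis
    using coord_less_iff[OF assms] di unfolding vec_less_def below_def by auto
qed

section \<open>Size of a class of equal labels\<close>

lemma support_eqI:
  assumes A: "A \<in> hd_permutations n k" and x: "x \<in> support n k A" and y: "y \<in> support n k A"
    and eq: "\<And>j. j \<in> J \<Longrightarrow> coord x j = coord y j"
  shows "x = y"
proof (rule support_line_unique[OF A x y i])
  fix l assume "l \<in> {1..k+1} - {i}"
  then show "x l = y l" using eq[of l] coord_eq_iff[of x y l] x y
    by (auto simp: J_def support_def)
qed

text \<open>The points of \<open>upper\<close> are determined by \<open>k - 1\<close> coordinates,
  which gives \<open>n ^ (k - 1)\<close>. The others are determined by their diagonals, each of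
  which has a representative with one of \<open>k\<close> coordinates equal to 0, which gives
  \<open>k * n ^ (k - 1)\<close>.\<close>

lemma card_class_le:
  assumes A: "A \<in> hd_permutations n k" and S: "S \<subseteq> support n k A"
    and comp: "\<And>x y. x \<in> S \<Longrightarrow> y \<in> S \<Longrightarrow> below x y \<Longrightarrow> x i = y i"
  shows "card S \<le> (k + 1) * n ^ (k - 1)"
proof -
  have pos: "x \<in> positions n k" if "x \<in> S" for x
    using that S by (auto simp: support_def)
  have J_sub: "j \<in> {1..k+1}" if "j \<in> J" for j using that by (auto simp: J_def)
  have finS: "finite S" using S finite_support finite_subset by blast
  \<comment> \<open>These are the points of \<open>S\<close> that are not lowest in \<open>S\<close>
    on their diagonal.\<close>
  define upper where
    "upper = {x \<in> S. \<exists>y\<in>S. \<exists>t>0. \<forall>j\<in>J. coord x j = coord y j + t}"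
  \<comment> \<open>Subtracting the least coordinate slides a point down its diagonal to the
    boundary, so \<open>proj\<close> names the diagonal and \<open>height\<close> the place on
    it.\<close>
  define height where "height x = Min (coord x ` J)" for x
  define proj where "proj x = (\<lambda>j\<in>J. coord x j - height x)" for x
  have height_le: "height x \<le> coord x j" if "j \<in> J" for x j
    unfolding height_def using that by simp
  have height_in: "\<exists>j\<in>J. coord x j = height x" for x
  proof -
    have "Min (coord x ` J) \<in> coord x ` J" using J_nonempty by (intro Min_in) auto
    then show ?thesis unfolding height_def by (auto simp: image_iff)
  qed

  obtain j where j: "j \<in> J" using J_nonempty by blast
  \<comment> \<open>The assumption \<open>less\<close> turns out to be contradictory. The point
    \<open>z\<close> diagonally below \<open>x\<close> is also below \<open>y\<close>: the shared
    coordinates exceed those of \<open>z\<close> by \<open>t\<close>, and the coordinate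
    \<open>j\<close> of \<open>y\<close> is larger still. Hence \<open>x\<close> and
    \<open>y\<close> agree at \<open>i\<close> and lie on one line in direction
    \<open>j\<close>.\<close>
  have same: "x j = y j"
    if xy: "x \<in> upper" "y \<in> upper" and eq: "\<And>l. l \<in> J - {j} \<Longrightarrow> x l = y l"
      and less: "coord x j < coord y j" for x y
  proof -
    from xy obtain z t where z: "z \<in> S" "t > 0" "\<forall>l\<in>J. coord x l = coord z l + t"
      by (auto simp: upper_def)
    have "below z x" using z by (auto simp: below_def)
    moreover have "below z y"
      unfolding below_def
    proof
      fix l assume l: "l \<in> J"
      show "coord z l < coord y l"
      proof (cases "l = j")
        case True
        then show ?thesis using less z(3) l by auto
      next
        case False
        then have "coord x l = coord y l" using eq[of l] l by (simp add: coord_def)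
        then show ?thesis using z l by fastforce
      qed
    qed
    moreover have "x \<in> S" "y \<in> S" using xy by (auto simp: upper_def)
    ultimately have "x i = y i" using comp[OF z(1)] by metis
    moreover have "{1..k+1} - {j} \<subseteq> insert i (J - {j})" by (auto simp: J_def)
    ultimately have "x = y"
      using xy S eq J_sub[OF j] by (intro support_line_unique[OF A]) (auto simp: upper_def)
    then show ?thesis by simp
  qed
  have "inj_on (\<lambda>x. restrict x (J - {j})) upper"
  proof (rule inj_onI)
    fix x y assume xy: "x \<in> upper" "y \<in> upper"
      and r: "restrict x (J - {j}) = restrict y (J - {j})"
    have eq: "x l = y l" if "l \<in> J - {j}" for l
      using fun_cong[OF r, of l] that by simp
    have p: "x \<in> positions n k" "y \<in> positions n k" using xy pos by (auto simp: upper_def)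
    have "x j = y j"
      using same[OF xy] same[OF xy(2,1)] eq coord_eq_iff[OF p J_sub[OF j]]
      by (metis linorder_neqE_nat)
    then have "coord x l = coord y l" if "l \<in> J" for l
      using eq[of l] that by (cases "l = j") (auto simp: coord_def)
    then show "x = y" using xy S by (intro support_eqI[OF A]) (auto simp: upper_def)
  qed
  moreover have "(\<lambda>x. restrict x (J - {j})) ` upper \<subseteq> (J - {j}) \<rightarrow>\<^sub>E {1..n}"
  proof (intro image_subsetI)
    fix x assume "x \<in> upper"
    then have "x \<in> positions n k" using pos by (auto simp: upper_def)
    then show "restrict x (J - {j}) \<in> (J - {j}) \<rightarrow>\<^sub>E {1..n}"
      using positions_range[of x] J_sub by (intro restrict_PiE_iff[THEN iffD2]) auto
  qed
  ultimately have "card upper \<le> card ((J - {j}) \<rightarrow>\<^sub>E {1..n})"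
    by (intro card_inj_on_le) (auto intro: finite_PiE)
  then have upper_le: "card upper \<le> n ^ (k - 1)"
    using j by (simp add: card_PiE card_J)

  \<comment> \<open>Of two points on one diagonal, the higher one would belong to
    \<open>upper\<close>.\<close>
  have not_higher: "height x \<le> height y"
    if xy: "x \<in> S - upper" "y \<in> S - upper" and eq: "proj x = proj y" for x y
  proof (rule ccontr)
    assume less: "\<not> height x \<le> height y"
    have "coord x l = coord y l + (height x - height y)" if "l \<in> J" for l
      using fun_cong[OF eq, of l] height_le[OF that, of x] height_le[OF that, of y] that less
      by (simp add: proj_def)
    moreover have "height x - height y > 0" using less by simp
    ultimately have "x \<in> upper" using xy unfolding upper_def by blast
    with xy show False by blast
  qed
  have "inj_on proj (S - upper)"
  proof (rule inj_onI)
    fix x y assume xy: "x \<in> S - upper" "y \<in> S - upper" and eq: "proj x = proj y"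
    have "height x = height y"
      using not_higher[OF xy eq] not_higher[OF xy(2,1) eq[symmetric]] by simp
    then have "coord x l = coord y l" if "l \<in> J" for l
      using fun_cong[OF eq, of l] height_le[OF that, of x] height_le[OF that, of y] that
      by (simp add: proj_def)
    then show "x = y" using xy S by (intro support_eqI[OF A]) auto
  qed
  moreover have "proj ` (S - upper) \<subseteq> (\<Union>l\<in>J. {g \<in> J \<rightarrow>\<^sub>E {..<n}. g l = 0})"
  proof clarify
    fix x assume x: "x \<in> S"
    obtain l where l: "l \<in> J" "coord x l = height x" using height_in by blast
    have "proj x \<in> J \<rightarrow>\<^sub>E {..<n}"
      using coord_less[OF pos[OF x] J_sub] by (auto simp: proj_def less_imp_diff_less)
    moreover have "proj x l = 0" using l by (simp add: proj_def)
    ultimately show "proj x \<in> (\<Union>l\<in>J. {g \<in> J \<rightarrow>\<^sub>E {..<n}. g l = 0})" using l by blast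
  qed
  ultimately have "card (S - upper) \<le> card (\<Union>l\<in>J. {g \<in> J \<rightarrow>\<^sub>E {..<n}. g l = 0})"
    by (intro card_inj_on_le) (auto intro: finite_subset[OF _ finite_PiE[of J "\<lambda>_. {..<n}"]])
  also have "\<dots> \<le> (\<Sum>l\<in>J. card {g \<in> J \<rightarrow>\<^sub>E {..<n}. g l = 0})"
    by (rule card_UN_le) simp
  also have "\<dots> \<le> of_nat (card J) * n ^ (k - 1)"
    using card_PiE_fixed_le[of J _ "{..<n}" 0] by (intro sum_bounded_above) (simp add: card_J)
  finally have "card (S - upper) \<le> k * n ^ (k - 1)" by (simp add: card_J)
  moreover have "card S = card (S - upper) + card upper"
    using finS card_Diff_subset[of upper S] card_mono[of S upper]
    by (auto simp: upper_def finite_subset)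
  ultimately show ?thesis using upper_le by simp
qed

text \<open>The pairs of labels split the support, of size at least \<open>n ^ k\<close>, into fewer
  than \<open>r * s\<close> classes of size at most \<open>(k + 1) * n ^ (k - 1)\<close>. The factor
  \<open>n ^ (k - 1)\<close> cancels because \<open>n\<close> is positive.\<close>

lemma monotone_free_bound:
  assumes A: "A \<in> hd_permutations n k" and n: "0 < n"
    and noc: "\<not> has_monotone_subseq n k c A r" and nod: "\<not> has_monotone_subseq n k d A s"
  shows "n \<le> r * s * (k + 1)"
proof -
  let ?G = "support n k A"
  from monotone_label[OF noc]
  obtain h where h: "h ` ?G \<subseteq> {1..<r}"
    "\<forall>x\<in>?G. \<forall>y\<in>?G. vec_less k c x y \<longrightarrow> h x < h y"
    by blast
  from monotone_label[OF nod]
  obtain h' where h': "h' ` ?G \<subseteq> {1..<s}"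
    "\<forall>x\<in>?G. \<forall>y\<in>?G. vec_less k d x y \<longrightarrow> h' x < h' y"
    by blast
  have "card ?G \<le> card ({1..<r} \<times> {1..<s}) * ((k + 1) * n ^ (k - 1))"
  proof (rule card_le_fibers[where f = "\<lambda>x. (h x, h' x)"])
    show "(\<lambda>x. (h x, h' x)) ` ?G \<subseteq> {1..<r} \<times> {1..<s}" using h(1) h'(1) by auto
    fix p
    show "card {x \<in> ?G. (h x, h' x) = p} \<le> (k + 1) * n ^ (k - 1)"
    proof (rule card_class_le[OF A])
      fix x y assume xy: "x \<in> {x \<in> ?G. (h x, h' x) = p}" "y \<in> {x \<in> ?G. (h x, h' x) = p}"
        and b: "below x y"
      then have p: "x \<in> positions n k" "y \<in> positions n k" by (auto simp: support_def)
      have G: "x \<in> ?G" "y \<in> ?G" and "h x = h y" "h' x = h' y" using xy by auto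
      \<comment> \<open>If \<open>x\<close> is below \<open>y\<close>, a difference at
        \<open>i\<close> in either direction would make one of the two labels increase.\<close>
      then have "\<not> x i < y i" "\<not> y i < x i"
        using h(2)[rule_format, OF G] h'(2)[rule_format, OF G] b vec_less_c[OF p] vec_less_d[OF p] by auto
      then show "x i = y i" by simp
    qed auto
  qed (auto intro: finite_support)
  also have "\<dots> \<le> r * s * ((k + 1) * n ^ (k - 1))"
    by (intro mult_le_mono1) (simp add: card_cartesian_product mult_le_mono)
  finally have "n ^ k \<le> r * s * ((k + 1) * n ^ (k - 1))"
    using card_support_ge[OF A] by simp
  moreover have "n ^ k = n * n ^ (k - 1)" using k_pos by (cases k) auto
  ultimately have "n * n ^ (k - 1) \<le> r * s * (k + 1) * n ^ (k - 1)"
    by (simp only: mult.assoc)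
  then show ?thesis using n by simp
qed

section \<open>The construction for (ii)\<close>

definition coord_sum :: "(nat \<Rightarrow> nat) \<Rightarrow> nat" where
  "coord_sum x = (\<Sum>j\<in>J. coord x j)"

definition block_permutation :: "nat \<Rightarrow> (nat \<Rightarrow> nat) \<Rightarrow> nat" where
  "block_permutation b = (\<lambda>x\<in>positions n k.
     if x i = block_reversal n b (coord_sum x mod n) then 1 else 0)"

lemma support_block_permutation:
  "x \<in> support n k (block_permutation b) \<longleftrightarrow>
    x \<in> positions n k \<and> x i = block_reversal n b (coord_sum x mod n)"
  by (auto simp: support_def block_permutation_def)

lemma coord_sum_less:
  assumes "x \<in> positions n k"
  shows "coord_sum x < k * n"
proof -
  have "coord_sum x < (\<Sum>j\<in>J. n)"
    unfolding coord_sum_def using J_nonempty coord_less[OF assms]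
    by (intro sum_strict_mono) (auto simp: J_def)
  then show ?thesis by (simp add: card_J)
qed

lemma coord_sum_step:
  assumes "below x y"
  shows "coord_sum x + k \<le> coord_sum y"
proof -
  have "(\<Sum>j\<in>J. coord x j + 1) \<le> (\<Sum>j\<in>J. coord y j)"
    using assms by (intro sum_mono) (auto simp: below_def Suc_le_eq)
  then show ?thesis by (simp add: coord_sum_def sum_Suc card_J)
qed

text \<open>In direction \<open>i\<close> the sum is constant and prescribes the value at
  \<open>i\<close>. In any other direction the sum meets every residue once, so the bijection
  \<open>block_reversal\<close> takes the fixed value \<open>a i\<close> exactly once.\<close>

lemma block_permutation_line:
  assumes b: "0 < b" and l: "l \<in> {1..k+1}" and a: "a \<in> ({1..k+1} - {l}) \<rightarrow>\<^sub>E {1..n}"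
  shows "\<exists>!x. x \<in> line_through n k l a \<and> block_permutation b x = 1"
proof -
  have J0: "{1..k+1} - {l} \<noteq> {}"
  proof -
    have "card ({1..k+1} - {l}) = k" using l by simp
    then show ?thesis using k_pos by (metis card.empty less_irrefl)
  qed
  then obtain m where "m \<in> {1..k+1} - {l}" by blast
  then have n: "0 < n" using PiE_mem[OF a] by fastforce
  define pt where "pt t = a(l := t)" for t
  have line: "line_through n k l a = pt ` {1..n}"
  proof (intro set_eqI iffI)
    fix x assume x: "x \<in> line_through n k l a"
    have "x = pt (x l)"
    proof
      fix m show "x m = pt (x l) m"
        using x a by (cases "m \<in> {1..k+1}")
          (auto simp: line_through_def pt_def positions_def PiE_def extensional_def)
    qed
    moreover have "x l \<in> {1..n}"
      using x l by (auto simp: line_through_def positions_def PiE_def Pi_def)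
    ultimately show "x \<in> pt ` {1..n}" by blast
  next
    fix x assume "x \<in> pt ` {1..n}"
    then obtain t where t: "t \<in> {1..n}" "x = pt t" by blast
    have "a(l := t) \<in> insert l ({1..k+1} - {l}) \<rightarrow>\<^sub>E {1..n}"
      using t(1) a by (rule PiE_fun_upd)
    then show "x \<in> line_through n k l a"
      using t l by (auto simp: line_through_def positions_def pt_def insert_absorb)
  qed
  have one: "block_permutation b (pt t) = 1 \<longleftrightarrow>
      pt t i = block_reversal n b (coord_sum (pt t) mod n)" if "t \<in> {1..n}" for t
  proof -
    have "pt t \<in> positions n k" using line that by (auto simp: line_through_def)
    then show ?thesis by (simp add: block_permutation_def)
  qed
  have "\<exists>!t. t \<in> {1..n} \<and> pt t i = block_reversal n b (coord_sum (pt t) mod n)"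
  proof (cases "l = i")
    case True
    have "coord_sum (pt t) = coord_sum a" for t
      unfolding coord_sum_def coord_def pt_def True J_def by (intro sum.cong) auto
    moreover have "block_reversal n b (coord_sum a mod n) \<in> {1..n}"
      using block_reversal_image[OF b, of n] n by auto
    ultimately show ?thesis by (auto simp: pt_def True)
  next
    case False
    then have lJ: "l \<in> J" using l by (simp add: J_def)
    define R where "R = (\<Sum>j\<in>J - {l}. coord a j)"
    have cs: "coord_sum (pt t) = coord (pt t) l + R" for t
    proof -
      have "coord_sum (pt t) = coord (pt t) l + (\<Sum>j\<in>J - {l}. coord (pt t) j)"
        unfolding coord_sum_def using lJ by (simp add: sum.remove)
      also have "(\<Sum>j\<in>J - {l}. coord (pt t) j) = R"
        unfolding R_def by (intro sum.cong) (auto simp: coord_def pt_def)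
      finally show ?thesis .
    qed
    define \<phi> where "\<phi> t = coord_sum (pt t) mod n" for t
    \<comment> \<open>The free coordinate enters the sum once and has \<open>n\<close> consecutive
      values, so the residues are distinct.\<close>
    have "inj_on \<phi> {1..n}"
    proof (rule inj_onI)
      fix t u assume t: "t \<in> {1..n}" and u: "u \<in> {1..n}" and eq: "\<phi> t = \<phi> u"
      have "coord (pt t) l < n" "coord (pt u) l < n"
        using t u by (auto simp: coord_def pt_def)
      then have "coord (pt t) l = coord (pt u) l"
        using eq unfolding \<phi>_def cs by (rule add_mod_cancel)
      then show "t = u" using t u by (auto simp: coord_def pt_def split: if_splits)
    qed
    moreover have \<phi>_less: "\<phi> t < n" for t using n by (simp add: \<phi>_def)
    ultimately have "inj_on (block_reversal n b \<circ> \<phi>) {1..n}"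
      by (intro comp_inj_on inj_on_subset[OF inj_on_block_reversal[OF b, of n]]) auto
    then have "inj_on (\<lambda>t. block_reversal n b (\<phi> t)) {1..n}" by (simp add: comp_def)
    moreover have "(\<lambda>t. block_reversal n b (\<phi> t)) ` {1..n} \<subseteq> {1..n}"
      using block_reversal_image[OF b, of n] \<phi>_less by blast
    ultimately have bij: "bij_betw (\<lambda>t. block_reversal n b (\<phi> t)) {1..n} {1..n}"
      by (simp add: bij_betw_def endo_inj_surj)
    have "a i \<in> {1..n}" using a i False by (auto simp: PiE_def Pi_def)
    then have "\<exists>!t. t \<in> {1..n} \<and> a i = block_reversal n b (\<phi> t)"
      using bij unfolding bij_betw_def inj_on_def by (metis (no_types, lifting) imageE)
    then show ?thesis using False by (simp add: pt_def \<phi>_def)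
  qed
  then obtain t where t: "t \<in> {1..n}" "block_permutation b (pt t) = 1"
    and uniq: "\<And>u. u \<in> {1..n} \<Longrightarrow> block_permutation b (pt u) = 1 \<Longrightarrow> u = t"
    using one by (metis (no_types, lifting))
  show ?thesis
  proof (rule ex1I[of _ "pt t"])
    show "pt t \<in> line_through n k l a \<and> block_permutation b (pt t) = 1" using t line by blast
    fix x assume x: "x \<in> line_through n k l a \<and> block_permutation b x = 1"
    then have "x \<in> pt ` {1..n}" by (simp only: line)
    then obtain u where "u \<in> {1..n}" "x = pt u" by (elim imageE)
    then show "x = pt t" using uniq[of u] x by simp
  qed
qed

lemma block_permutation_in:
  assumes "0 < b"
  shows "block_permutation b \<in> hd_permutations n k"
  unfolding hd_permutations_def
proof (intro CollectI conjI ballI)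
  show "block_permutation b \<in> positions n k \<rightarrow>\<^sub>E {0, 1}"
    by (auto simp: block_permutation_def)
next
  fix L assume "L \<in> lines n k"
  then obtain l a where "L = line_through n k l a" "l \<in> {1..k+1}"
    "a \<in> ({1..k+1} - {l}) \<rightarrow>\<^sub>E {1..n}"
    unfolding lines_def by blast
  then show "\<exists>!x. x \<in> L \<and> block_permutation b x = 1"
    using block_permutation_line[OF assms] by simp
qed

section \<open>Monotone subsequences in the construction\<close>

lemma block_permutation_period:
  assumes "x \<in> support n k (block_permutation b)"
  shows "coord_sum x div n < k" "0 < n"
proof -
  have "coord_sum x < k * n"
    using assms coord_sum_less support_block_permutation by blast
  then show "coord_sum x div n < k" "0 < n"
    by (auto simp: less_mult_imp_div_less intro: gr0I)
qed

text \<open>The block number cannot drop while the values increase, and within one block of one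
  period a larger sum would give a smaller value. Hence \<open>f\<close> increases strictly; its two
  summands are at most \<open>k - 1\<close> and \<open>(n - 1) div b\<close>.\<close>

lemma no_monotone_c:
  assumes b: "0 < b" and r: "k + (n - 1) div b < r"
  shows "\<not> has_monotone_subseq n k c (block_permutation b) r"
proof
  assume "has_monotone_subseq n k c (block_permutation b) r"
  then obtain \<alpha> where sup: "\<And>j. j \<in> {1..r} \<Longrightarrow> \<alpha> j \<in> support n k (block_permutation b)"
    and less: "\<And>j. j \<in> {1..<r} \<Longrightarrow> vec_less k c (\<alpha> j) (\<alpha> (j + 1))"
    unfolding has_monotone_subseq_def monotone_subseq_def by blast
  define \<sigma> where "\<sigma> j = coord_sum (\<alpha> j)" for j
  define f where "f j = \<sigma> j div n + \<sigma> j mod n div b" for j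
  have "r \<le> k + (n - 1) div b"
  proof (rule strict_chain_length_le[of r f])
    fix j assume j: "j \<in> {1..<r}"
    then have s: "\<alpha> j \<in> support n k (block_permutation b)"
      "\<alpha> (j + 1) \<in> support n k (block_permutation b)" using sup by auto
    then have p: "\<alpha> j \<in> positions n k" "\<alpha> (j + 1) \<in> positions n k" by (auto simp: support_def)
    have n: "0 < n" using block_permutation_period(2) s by blast
    have bl: "below (\<alpha> j) (\<alpha> (j + 1))"
      and val: "block_reversal n b (\<sigma> j mod n) < block_reversal n b (\<sigma> (j + 1) mod n)"
      using less[OF j] vec_less_c[OF p] s support_block_permutation by (auto simp: \<sigma>_def)
    have \<sigma>: "\<sigma> j < \<sigma> (j + 1)" using coord_sum_step[OF bl] k_pos by (simp add: \<sigma>_def)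
    have q: "\<sigma> j mod n div b \<le> \<sigma> (j + 1) mod n div b"
      using block_reversal_blocks[of "\<sigma> (j + 1) mod n" n "\<sigma> j mod n" b] n b val by force
    have d: "\<sigma> j div n \<le> \<sigma> (j + 1) div n" using \<sigma> by (simp add: div_le_mono)
    have "\<not> (\<sigma> j div n = \<sigma> (j + 1) div n \<and> \<sigma> j mod n div b = \<sigma> (j + 1) mod n div b)"
    proof
      assume eq: "\<sigma> j div n = \<sigma> (j + 1) div n \<and> \<sigma> j mod n div b = \<sigma> (j + 1) mod n div b"
      then have "\<sigma> j div n * n = \<sigma> (j + 1) div n * n" by simp
      then have "\<sigma> j mod n < \<sigma> (j + 1) mod n"
        using \<sigma> div_mult_mod_eq[of "\<sigma> j" n] div_mult_mod_eq[of "\<sigma> (j + 1)" n] by linarith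
      then show False
        using block_reversal_within[of "\<sigma> (j + 1) mod n" n b "\<sigma> j mod n"] eq n b val by simp
    qed
    then show "f j < f (j + 1)" using q d unfolding f_def by linarith
  next
    fix j assume "j \<in> {1..r}"
    then have s: "\<alpha> j \<in> support n k (block_permutation b)" using sup by auto
    then have n: "0 < n" using block_permutation_period(2) by blast
    then have "\<sigma> j mod n \<le> n - 1" using mod_less_divisor[of n "\<sigma> j"] by linarith
    then have "\<sigma> j mod n div b \<le> (n - 1) div b" by (rule div_le_mono)
    then show "f j < k + (n - 1) div b"
      using block_permutation_period(1)[OF s] by (simp add: f_def \<sigma>_def)
  qed
  then show False using r by simp
qed

text \<open>Cut each block into slots of \<open>k\<close> consecutive residues. Within a period the
  block stays the same, and each step of at least \<open>k\<close> leaves the current slot, so every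
  slot is visited at most once.\<close>

lemma no_monotone_d:
  assumes b: "0 < b" and s: "b + k \<le> s"
  shows "\<not> has_monotone_subseq n k d (block_permutation b) s"
proof
  assume "has_monotone_subseq n k d (block_permutation b) s"
  then obtain \<alpha> where sup: "\<And>j. j \<in> {1..s} \<Longrightarrow> \<alpha> j \<in> support n k (block_permutation b)"
    and less: "\<And>j. j \<in> {1..<s} \<Longrightarrow> vec_less k d (\<alpha> j) (\<alpha> (j + 1))"
    unfolding has_monotone_subseq_def monotone_subseq_def by blast
  define \<sigma> where "\<sigma> j = coord_sum (\<alpha> j)" for j
  \<comment> \<open>This is \<open>b / k\<close> rounded up, the number of slots in a block of
    length \<open>b\<close>.\<close>
  define C where "C = (b - 1) div k + 1"
  \<comment> \<open>Slot numbers are less than \<open>C\<close>, so \<open>f\<close> orders pairs of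
    period and slot lexicographically.\<close>
  define f where "f j = \<sigma> j div n * C + \<sigma> j mod n mod b div k" for j
  have slot: "\<sigma> j mod n mod b div k < C" for j
  proof -
    have "\<sigma> j mod n mod b \<le> b - 1"
      using b mod_less_divisor[of b "\<sigma> j mod n"] by linarith
    then show ?thesis using div_le_mono[of "\<sigma> j mod n mod b" "b - 1" k] by (simp add: C_def)
  qed
  have "s \<le> k * C"
  proof (rule strict_chain_length_le[of s f])
    fix j assume j: "j \<in> {1..<s}"
    then have s: "\<alpha> j \<in> support n k (block_permutation b)"
      "\<alpha> (j + 1) \<in> support n k (block_permutation b)" using sup by auto
    then have p: "\<alpha> j \<in> positions n k" "\<alpha> (j + 1) \<in> positions n k" by (auto simp: support_def)
    have n: "0 < n" using block_permutation_period(2) s by blast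
    have bl: "below (\<alpha> j) (\<alpha> (j + 1))"
      and val: "block_reversal n b (\<sigma> (j + 1) mod n) < block_reversal n b (\<sigma> j mod n)"
      using less[OF j] vec_less_d[OF p] s support_block_permutation by (auto simp: \<sigma>_def)
    have \<sigma>: "\<sigma> j + k \<le> \<sigma> (j + 1)" using coord_sum_step[OF bl] by (simp add: \<sigma>_def)
    then have "\<sigma> j div n \<le> \<sigma> (j + 1) div n" by (simp add: div_le_mono)
    then consider "\<sigma> j div n < \<sigma> (j + 1) div n" | "\<sigma> j div n = \<sigma> (j + 1) div n" by linarith
    then show "f j < f (j + 1)"
    proof cases
      case 1
      then have "\<sigma> j div n * C + C \<le> \<sigma> (j + 1) div n * C"
        using mult_le_mono1[of "Suc (\<sigma> j div n)" "\<sigma> (j + 1) div n" C] by simp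
      then show ?thesis using slot[of j] unfolding f_def by linarith
    next
      case 2
      then have "\<sigma> j div n * n = \<sigma> (j + 1) div n * n" by simp
      then have m: "\<sigma> j mod n + k \<le> \<sigma> (j + 1) mod n"
        using \<sigma> div_mult_mod_eq[of "\<sigma> j" n] div_mult_mod_eq[of "\<sigma> (j + 1)" n] by linarith
      then have "\<sigma> j mod n div b \<le> \<sigma> (j + 1) mod n div b" by (simp add: div_le_mono)
      \<comment> \<open>A later block would carry larger values, whereas the values
        decrease.\<close>
      moreover have "\<not> \<sigma> j mod n div b < \<sigma> (j + 1) mod n div b"
        using block_reversal_blocks[of "\<sigma> j mod n" n "\<sigma> (j + 1) mod n" b] n b val by force
      ultimately have "\<sigma> j mod n div b * b = \<sigma> (j + 1) mod n div b * b" by simp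
      then have "\<sigma> j mod n mod b + k \<le> \<sigma> (j + 1) mod n mod b"
        using m div_mult_mod_eq[of "\<sigma> j mod n" b] div_mult_mod_eq[of "\<sigma> (j + 1) mod n" b]
        by linarith
      then have "(\<sigma> j mod n mod b + k) div k \<le> \<sigma> (j + 1) mod n mod b div k"
        by (rule div_le_mono)
      then show ?thesis using k_pos 2 by (simp add: f_def)
    qed
  next
    fix j assume "j \<in> {1..s}"
    then have "\<sigma> j div n < k" unfolding \<sigma>_def by (intro block_permutation_period(1)[OF sup])
    then have "\<sigma> j div n * C + C \<le> k * C"
      using mult_le_mono1[of "Suc (\<sigma> j div n)" k C] by simp
    then show "f j < k * C" using slot[of j] unfolding f_def by linarith
  qed
  \<comment> \<open>Rounding up costs at most \<open>k - 1\<close>, which keeps the length strictly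
    below \<open>b + k\<close>.\<close>
  also have "k * C \<le> b - 1 + k" by (simp add: C_def)
  finally show False using s b by linarith
qed

section \<open>Numerical bounds and the two sign cases\<close>

lemma has_monotone_subseq_either:
  assumes k2: "2 \<le> k" and rs: "real (r * s) < real n / (3 * (real k - 1))"
    and A: "A \<in> hd_permutations n k"
  shows "has_monotone_subseq n k c A r \<or> has_monotone_subseq n k d A s"
proof (rule ccontr)
  assume no: "\<not> ?thesis"
  have lt: "real (r * s) * (3 * (real k - 1)) < real n"
    using rs k2 by (simp add: pos_less_divide_eq)
  moreover have "0 \<le> real (r * s) * (3 * (real k - 1))" using k2 by simp
  ultimately have "0 < n" by linarith
  then have "n \<le> r * s * (k + 1)" using monotone_free_bound[OF A] no by blast
  then have "real n \<le> real (r * s * (k + 1))" by (rule of_nat_mono)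
  also have "\<dots> = real (r * s) * (real k + 1)" by (simp add: algebra_simps)
  \<comment> \<open>The inequality \<open>k + 1 \<le> 3 * (k - 1)\<close> amounts to
    \<open>2 \<le> k\<close>.\<close>
  also have "\<dots> \<le> real (r * s) * (3 * (real k - 1))"
    using k2 by (intro mult_left_mono) auto
  finally show False using lt by simp
qed

text \<open>The block length \<open>s - k\<close> is the largest one allowed by
  \<open>no_monotone_d\<close>. What \<open>no_monotone_c\<close> then asks for follows from
  \<open>n < (r - k) * (s - k)\<close>.\<close>

lemma ex_monotone_free:
  assumes r: "9 * (k + 10) \<le> r" and s: "9 * (k + 10) \<le> s" and rs: "5 * k * n < r * s"
  shows "\<exists>A \<in> hd_permutations n k.
    \<not> has_monotone_subseq n k c A r \<and> \<not> has_monotone_subseq n k d A s"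
proof -
  have b: "0 < s - k" using s by simp
  have "4 * n \<le> 5 * k * n" using k_pos by simp
  also have "\<dots> < r * s" by (rule rs)
  \<comment> \<open>Both \<open>r\<close> and \<open>s\<close> are at least \<open>2 * k\<close>, so
    subtracting \<open>k\<close> at most halves them.\<close>
  also have "\<dots> \<le> (2 * (r - k)) * (2 * (s - k))" using r s by (intro mult_le_mono) auto
  finally have "n < (r - k) * (s - k)" by simp
  then have "(n - 1) div (s - k) < r - k" by (intro less_mult_imp_div_less) simp
  then have "k + (n - 1) div (s - k) < r" by simp
  then show ?thesis
    using no_monotone_c[OF b, of r] no_monotone_d[OF b, of s] s block_permutation_in[OF b]
    by (intro bexI[of _ "block_permutation (s - k)"]) auto
qed

end

theorem theorem12:
  fixes n k :: nat and c d :: "nat \<Rightarrow> nat"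
  assumes "k \<ge> 2"
    and "c \<in> sign_vectors k" and "d \<in> sign_vectors k"
    and "\<exists>!i. i \<in> {1..k+1} \<and> c i \<noteq> d i"
  shows "(\<forall>r s :: nat. r > 0 \<longrightarrow> s > 0 \<longrightarrow>
            real (r * s) < real n / (3 * (real k - 1)) \<longrightarrow>
            (\<forall>A \<in> hd_permutations n k.
               has_monotone_subseq n k c A r \<or> has_monotone_subseq n k d A s))
       \<and> (\<forall>r s :: nat. r \<ge> 9 * (k + 10) \<longrightarrow> s \<ge> 9 * (k + 10) \<longrightarrow>
            r * s > 5 * k * n \<longrightarrow>
            (\<exists>A \<in> hd_permutations n k.
               \<not> has_monotone_subseq n k c A r \<and> \<not> has_monotone_subseq n k d A s))"
proof -
  obtain i where i: "i \<in> {1..k+1}" "c i \<noteq> d i"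
    and eq: "\<And>j. j \<in> {1..k+1} - {i} \<Longrightarrow> c j = d j"
    using assms(4) by blast
  have c01: "\<And>j. j \<in> {1..k+1} \<Longrightarrow> c j \<in> {0, 1}" and d01: "\<And>j. j \<in> {1..k+1} \<Longrightarrow> d j \<in> {0, 1}"
    using PiE_mem[OF assms(2)[unfolded sign_vectors_def]]
      PiE_mem[OF assms(3)[unfolded sign_vectors_def]] by blast+
  consider "c i = 1" "d i = 0" | "d i = 1" "c i = 0" using c01[OF i(1)] d01[OF i(1)] i(2) by auto
  then show ?thesis
  proof cases
    case 1
    interpret opposed_signs n k i c d
    proof
      show "0 < k" using assms(1) by simp
      fix j assume j: "j \<in> {1..k+1} - {i}"
      then show "c j \<in> {0, 1}" using c01 by blast
      show "d j = c j" using eq[OF j] by simp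
    qed (use i 1 in auto)
    show ?thesis using has_monotone_subseq_either[OF assms(1)] ex_monotone_free by blast
  next
    case 2
    \<comment> \<open>The two vectors exchange roles, and \<open>r\<close> and \<open>s\<close> with
      them; the numerical conditions are symmetric in \<open>r\<close> and \<open>s\<close>.\<close>
    interpret opposed_signs n k i d c
    proof
      show "0 < k" using assms(1) by simp
      fix j assume j: "j \<in> {1..k+1} - {i}"
      then show "d j \<in> {0, 1}" using d01 by blast
      show "c j = d j" using eq[OF j] by simp
    qed (use i 2 in auto)
    show ?thesis
      using has_monotone_subseq_either[OF assms(1)] ex_monotone_free by (metis mult.commute)
  qed
qed

end
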